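(* Let $\mathcal P=(P;<)$ be a finite non-singleton chain with smallest element $0$, and let $w$ denote its unique atom. Let $\mathcal P'$ be its principal filter $\mathord{\uparrow}w$, that is, $P'=P\setminus\{0\}$ with the inherited ordering. On the lattice $\mathrm{CoalL}(\mathcal P')$ define the relation $$T:=\{(A,B)\in \mathrm{CoalL}(\mathcal P')^2 : A\cup\{w\}=B\cup\{w\}\}.$$ Then $T$ is a doubling tolerance on $\mathrm{CoalL}(\mathcal P')$, and $[\mathrm{CoalL}(\mathcal P')\ast_2 T]$ is isomorphic to $\mathrm{CoalL}(\mathcal P)$. Also, $T$ is a congruence, and both $\mathrm{CoalL}(\mathcal P')$ and $\mathrm{CoalL}(\mathcal P)$ are distributive lattices.
   Context: Coalitions: for a finite poset $\mathcal P=(P;<)$, let $\mathrm{Pow}(\mathcal P)$ be the set of all subsets of $P$. For $X,Y\in\mathrm{Pow}(\mathcal P)$, a map $\varphi\colon X\to Y$ is extensive if it is injective and $x\le\varphi(x)$ for every $x\in X$. Let $X\le Y$ mean that there exists an extensive map $X\to Y$. With this ordering, $\mathrm{CoalL}(\mathcal P)=(\mathrm{Pow}(\mathcal P);\le)$ is the coalition poset of $\mathcal P$. It is known that $\mathrm{CoalL}(\mathcal P)$ is a lattice whenever $\mathcal P$ is a finite chain. Doubling tolerances: a tolerance on a lattice $L$ is a reflexive and symmetric binary relation on $L$ compatible with both lattice operations. Its blocks are the maximal subsets $X$ of $L$ with $X\times X\subseteq T$. A doubling tolerance is a tolerance $T$ on a modular lattice $L$ of finite length such that every block of $T$ has at most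 two elements. (Thus the assertion that $T$ is a doubling tolerance on a lattice includes that this lattice is modular.) Doubling construction: for a doubling tolerance $T$ on $L$, write $a\prec_T b$ if $[a,b]$ is a two-element block of $T$; equivalently, if $(a,b)\in T$ and $a<b$. Let $\mathsf C_2=\{0,1\}$ be the two-element chain with $0\prec 1$. On $L\times\mathsf C_2$ let $((a,i),(b,j))\in\pi$ iff $a\le b$ in $L$ and $i\le j$ in $\mathsf C_2$; let $((a,i),(b,j))\in\tau$ iff $i=1$, $j=0$, and $a\prec_T b$; and let $\rho$ be the transitive closure of $\pi\cup\tau$. Then $[L\ast_2 T]$ denotes the structure $(L\times\mathsf C_2;\rho)$, with $\rho$ as its ordering. *)

theory Defs
  imports "HOL-Algebra.Lattice"
begin

section \<open>Ordered sets and lattices\<close>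

definition covers :: "('a, 'm) gorder_scheme \<Rightarrow> 'a \<Rightarrow> 'a \<Rightarrow> bool" where
  "covers L a b \<longleftrightarrow> a \<in> carrier L \<and> b \<in> carrier L \<and> a \<sqsubset>\<^bsub>L\<^esub> b \<and>
     \<not> (\<exists>x\<in>carrier L. a \<sqsubset>\<^bsub>L\<^esub> x \<and> x \<sqsubset>\<^bsub>L\<^esub> b)"

definition is_atom :: "('a, 'm) gorder_scheme \<Rightarrow> 'a \<Rightarrow> bool" where
  "is_atom L w \<longleftrightarrow> (\<exists>z. least L z (carrier L) \<and> covers L z w)"

definition principal_filter :: "('a, 'm) gorder_scheme \<Rightarrow> 'a \<Rightarrow> ('a, 'm) gorder_scheme" where
  "principal_filter L w = L\<lparr>carrier := {x \<in> carrier L. w \<sqsubseteq>\<^bsub>L\<^esub> x}\<rparr>"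

text \<open>In a chain, the principal filter of the atom consists of everything but the least element.\<close>

lemma principal_filter_atom:
  assumes "total_order P" and "least P z (carrier P)" and "is_atom P w"
  shows "principal_filter P w = P\<lparr>carrier := carrier P - {z}\<rparr>"
proof -
  interpret total_order P by fact
  obtain z' where z': "least P z' (carrier P)" and c: "covers P z' w"
    using assms(3) by (auto simp: is_atom_def)
  have "z' = z"
    using z' assms(2) by (auto simp: least_def intro: le_antisym)
  then have w: "w \<in> carrier P" "w \<noteq> z" "z \<sqsubseteq>\<^bsub>P\<^esub> w" and z: "z \<in> carrier P"
    and nb: "\<And>x. x \<in> carrier P \<Longrightarrow> z \<sqsubset>\<^bsub>P\<^esub> x \<Longrightarrow> x \<sqsubset>\<^bsub>P\<^esub> w \<Longrightarrow> False"
    using c by (auto simp: covers_def lless_eq)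
  have "w \<sqsubseteq>\<^bsub>P\<^esub> x \<longleftrightarrow> x \<noteq> z" if x: "x \<in> carrier P" for x
  proof
    assume "w \<sqsubseteq>\<^bsub>P\<^esub> x"
    then show "x \<noteq> z"
      using w z le_antisym by blast
  next
    assume "x \<noteq> z"
    moreover have "z \<sqsubseteq>\<^bsub>P\<^esub> x"
      using assms(2) x by (auto simp: least_def)
    ultimately have "\<not> x \<sqsubset>\<^bsub>P\<^esub> w"
      using nb[OF x] by (auto simp: lless_eq)
    then show "w \<sqsubseteq>\<^bsub>P\<^esub> x"
      using total_order_total[OF x w(1)] w(1) by (auto simp: lless_eq)
  qed
  then have "{x \<in> carrier P. w \<sqsubseteq>\<^bsub>P\<^esub> x} = carrier P - {z}"
    by auto
  then show ?thesis
    by (simp add: principal_filter_def)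
qed

definition order_isomorphic ::
    "('a, 'm) gorder_scheme \<Rightarrow> ('b, 'n) gorder_scheme \<Rightarrow> bool" where
  "order_isomorphic A B \<longleftrightarrow> (\<exists>f. order_emb A B f \<and> bij_betw f (carrier A) (carrier B))"

definition finite_length :: "('a, 'm) gorder_scheme \<Rightarrow> bool" where
  "finite_length L \<longleftrightarrow>
     (\<exists>n. \<forall>C. C \<subseteq> carrier L \<and> (\<forall>x\<in>C. \<forall>y\<in>C. x \<sqsubseteq>\<^bsub>L\<^esub> y \<or> y \<sqsubseteq>\<^bsub>L\<^esub> x) \<longrightarrow> finite C \<and> card C \<le> n)"

definition modular_lattice :: "('a, 'm) gorder_scheme \<Rightarrow> bool" where
  "modular_lattice L \<longleftrightarrow> lattice L \<and>
     (\<forall>x\<in>carrier L. \<forall>y\<in>carrier L. \<forall>z\<in>carrier L.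
        x \<sqsubseteq>\<^bsub>L\<^esub> z \<longrightarrow> x \<squnion>\<^bsub>L\<^esub> (y \<sqinter>\<^bsub>L\<^esub> z) = (x \<squnion>\<^bsub>L\<^esub> y) \<sqinter>\<^bsub>L\<^esub> z)"

definition distributive_lattice :: "('a, 'm) gorder_scheme \<Rightarrow> bool" where
  "distributive_lattice L \<longleftrightarrow> lattice L \<and>
     (\<forall>x\<in>carrier L. \<forall>y\<in>carrier L. \<forall>z\<in>carrier L.
        x \<sqinter>\<^bsub>L\<^esub> (y \<squnion>\<^bsub>L\<^esub> z) = (x \<sqinter>\<^bsub>L\<^esub> y) \<squnion>\<^bsub>L\<^esub> (x \<sqinter>\<^bsub>L\<^esub> z))"

section \<open>Coalition posets\<close>

definition extensive :: "('a, 'm) gorder_scheme \<Rightarrow> 'a set \<Rightarrow> 'a set \<Rightarrow> ('a \<Rightarrow> 'a) \<Rightarrow> bool" where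
  "extensive P X Y \<phi> \<longleftrightarrow> \<phi> \<in> X \<rightarrow> Y \<and> inj_on \<phi> X \<and> (\<forall>x\<in>X. x \<sqsubseteq>\<^bsub>P\<^esub> \<phi> x)"

definition CoalL :: "('a, 'm) gorder_scheme \<Rightarrow> 'a set gorder" where
  "CoalL P = \<lparr>carrier = Pow (carrier P), eq = (=), le = (\<lambda>X Y. \<exists>\<phi>. extensive P X Y \<phi>)\<rparr>"

section \<open>Tolerances and congruences\<close>

definition compatible :: "('a, 'm) gorder_scheme \<Rightarrow> ('a \<times> 'a) set \<Rightarrow> bool" where
  "compatible L T \<longleftrightarrow>
     (\<forall>(a, b)\<in>T. \<forall>(c, d)\<in>T. (a \<squnion>\<^bsub>L\<^esub> c, b \<squnion>\<^bsub>L\<^esub> d) \<in> T \<and> (a \<sqinter>\<^bsub>L\<^esub> c, b \<sqinter>\<^bsub>L\<^esub> d) \<in> T)"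

definition tolerance :: "('a, 'm) gorder_scheme \<Rightarrow> ('a \<times> 'a) set \<Rightarrow> bool" where
  "tolerance L T \<longleftrightarrow> lattice L \<and> T \<subseteq> carrier L \<times> carrier L \<and> refl_on (carrier L) T \<and> sym T \<and>
     compatible L T"

definition congruence :: "('a, 'm) gorder_scheme \<Rightarrow> ('a \<times> 'a) set \<Rightarrow> bool" where
  "congruence L T \<longleftrightarrow> lattice L \<and> equiv (carrier L) T \<and> compatible L T"

definition blocks :: "('a, 'm) gorder_scheme \<Rightarrow> ('a \<times> 'a) set \<Rightarrow> 'a set set" where
  "blocks L T = {X. X \<subseteq> carrier L \<and> X \<times> X \<subseteq> T \<and>
     (\<forall>Y. X \<subseteq> Y \<and> Y \<subseteq> carrier L \<and> Y \<times> Y \<subseteq> T \<longrightarrow> Y = X)}"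

text \<open>The explicit finiteness is needed because \<open>card\<close> sends infinite sets to 0.\<close>

definition doubling_tolerance :: "('a, 'm) gorder_scheme \<Rightarrow> ('a \<times> 'a) set \<Rightarrow> bool" where
  "doubling_tolerance L T \<longleftrightarrow> modular_lattice L \<and> finite_length L \<and> tolerance L T \<and>
     (\<forall>X\<in>blocks L T. finite X \<and> card X \<le> 2)"

section \<open>The doubling construction\<close>

definition tol_prec :: "('a, 'm) gorder_scheme \<Rightarrow> ('a \<times> 'a) set \<Rightarrow> 'a \<Rightarrow> 'a \<Rightarrow> bool" where
  "tol_prec L T a b \<longleftrightarrow> a \<in> carrier L \<and> b \<in> carrier L \<and>
     \<lbrace>a..b\<rbrace>\<^bsub>L\<^esub> \<in> blocks L T \<and> card \<lbrace>a..b\<rbrace>\<^bsub>L\<^esub> = 2"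

text \<open>The two-element chain is \<open>{0, 1}\<close> with the ordering of the natural numbers.\<close>

definition doubling_pi :: "('a, 'm) gorder_scheme \<Rightarrow> (('a \<times> nat) \<times> ('a \<times> nat)) set" where
  "doubling_pi L = {((a, i), (b, j)) | a i b j.
     a \<in> carrier L \<and> b \<in> carrier L \<and> i \<in> {0, 1} \<and> j \<in> {0, 1} \<and> a \<sqsubseteq>\<^bsub>L\<^esub> b \<and> i \<le> j}"

definition doubling_tau ::
    "('a, 'm) gorder_scheme \<Rightarrow> ('a \<times> 'a) set \<Rightarrow> (('a \<times> nat) \<times> ('a \<times> nat)) set" where
  "doubling_tau L T = {((a, i), (b, j)) | a i b j. i = 1 \<and> j = 0 \<and> tol_prec L T a b}"

definition doubling :: "('a, 'm) gorder_scheme \<Rightarrow> ('a \<times> 'a) set \<Rightarrow> ('a \<times> nat) gorder" where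
  "doubling L T = \<lparr>carrier = carrier L \<times> {0, 1}, eq = (=),
     le = (\<lambda>x y. (x, y) \<in> (doubling_pi L \<union> doubling_tau L T)\<^sup>+)\<rparr>"

end

theory Submission
  imports Defs
begin

text \<open>
  A coalition \<open>X\<close> of a finite chain is encoded by the function that sends a threshold \<open>t\<close> to the
  number of members of \<open>X\<close> at or above \<open>t\<close>. Three facts make this encoding decisive.

  First, \<open>X \<le> Y\<close> holds in the coalition poset exactly when the function of \<open>X\<close> is pointwise at most
  that of \<open>Y\<close> (\<open>CoalL_le_iff\<close>); this is Hall's theorem in the easy case where the sets of
  admissible partners are nested. Second, the functions that occur are those that, going down the
  chain from 0 above the top, grow by 0 or 1 at each element. Third, such functions are closed under
  pointwise maximum and minimum (\<open>tail_count_realize\<close>). Hence the coalition poset is a sublattice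
  of a power of a chain of numbers, and so it is distributive, in particular modular.

  Let \<open>w\<close> be the least element of the chain. Equality of \<open>A \<union> {w}\<close> and \<open>B \<union> {w}\<close> means that the two
  functions agree at every threshold other than \<open>w\<close> (\<open>equal_off_iff\<close>). Since joins and meets are
  computed pointwise, this relation is a congruence. Its classes are the pairs \<open>A - {w}\<close>, \<open>A \<union> {w}\<close>,
  which gives the bound on the blocks and identifies \<open>\<prec>\<^sub>T\<close> as the insertion of \<open>w\<close>.

  For the doubled lattice, think of the label 1 as the presence of an additional member \<open>z\<close> below
  the whole chain. Adding \<open>z\<close> only raises the count at the new threshold \<open>z\<close>, which is the
  cardinality. Thus \<open>(A, i)\<close>, read as a coalition of the longer chain, lies below \<open>(B, j)\<close> iff
  \<open>A \<le> B\<close> and \<open>card A + i \<le> card B + j\<close>. The doubling construction has the same order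
  (\<open>doubling_le_iff\<close>): its generating pairs satisfy this condition, which is transitive, and
  conversely, when \<open>i = 1\<close> and \<open>j = 0\<close>, a pair \<open>A \<le> B\<close> with \<open>card A < card B\<close> leaves room for a step
  \<open>A' \<prec>\<^sub>T A' \<union> {w}\<close> between \<open>A\<close> and \<open>B\<close> (\<open>coalition_interpolate\<close>).
\<close>

section \<open>Coalitions of a finite chain as counting functions\<close>

definition tail_count :: "('a, 'm) gorder_scheme \<Rightarrow> 'a set \<Rightarrow> 'a \<Rightarrow> nat" where
  "tail_count P X t = card {x \<in> X. t \<sqsubseteq>\<^bsub>P\<^esub> x}"

definition strict_tail_count :: "('a, 'm) gorder_scheme \<Rightarrow> 'a set \<Rightarrow> 'a \<Rightarrow> nat" where
  "strict_tail_count P X t = card {x \<in> X. t \<sqsubset>\<^bsub>P\<^esub> x}"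

lemma CoalL_simps [simp]:
  "carrier (CoalL P) = Pow (carrier P)"
  "eq (CoalL P) = (=)"
  by (simp_all add: CoalL_def)

locale finite_chain = total_order P for P (structure) +
  assumes finite_carrier: "finite (carrier P)"
begin

lemma finite_coalition [simp]: "X \<subseteq> carrier P \<Longrightarrow> finite X"
  using finite_carrier finite_subset by blast

lemma chain_min:
  assumes "S \<subseteq> carrier P" "S \<noteq> {}"
  obtains m where "m \<in> S" "\<And>x. x \<in> S \<Longrightarrow> m \<sqsubseteq> x"
proof -
  have "\<exists>m\<in>S. \<forall>x\<in>S. x \<noteq> m \<longrightarrow> m \<sqsubseteq> x"
  proof (rule Finite_Set.bex_least_element)
    show "transp_on S (\<sqsubseteq>)"
      using assms by (auto simp: transp_on_def intro: le_trans)
    show "totalp_on S (\<sqsubseteq>)"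
      by (intro totalp_onI total) (use assms(1) in \<open>simp_all add: subsetD\<close>)
  qed (use assms in auto)
  then show thesis
    using assms that by (metis le_refl subsetD)
qed

lemma chain_max:
  assumes "S \<subseteq> carrier P" "S \<noteq> {}"
  obtains m where "m \<in> S" "\<And>x. x \<in> S \<Longrightarrow> x \<sqsubseteq> m"
proof -
  have "\<exists>m\<in>S. \<forall>x\<in>S. x \<noteq> m \<longrightarrow> x \<sqsubseteq> m"
  proof (rule Finite_Set.bex_greatest_element)
    show "transp_on S (\<sqsubseteq>)"
      using assms by (auto simp: transp_on_def intro: le_trans)
    show "totalp_on S (\<sqsubseteq>)"
      by (intro totalp_onI total) (use assms(1) in \<open>simp_all add: subsetD\<close>)
  qed (use assms in auto)
  then show thesis
    using assms that by (metis le_refl subsetD)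
qed

lemma extensive_imp_tail_count_le:
  assumes "extensive P X Y \<phi>" "X \<subseteq> carrier P" "Y \<subseteq> carrier P" "t \<in> carrier P"
  shows "tail_count P X t \<le> tail_count P Y t"
  unfolding tail_count_def
proof (rule card_inj_on_le[of \<phi>])
  show "inj_on \<phi> {x \<in> X. t \<sqsubseteq> x}"
    using assms(1) by (auto simp: extensive_def intro: inj_on_subset)
  show "\<phi> ` {x \<in> X. t \<sqsubseteq> x} \<subseteq> {y \<in> Y. t \<sqsubseteq> y}"
  proof
    fix y assume "y \<in> \<phi> ` {x \<in> X. t \<sqsubseteq> x}"
    then obtain x where "x \<in> X" "t \<sqsubseteq> x" "y = \<phi> x"
      by auto
    moreover from this have "\<phi> x \<in> Y" "x \<sqsubseteq> \<phi> x"
      using assms(1) by (auto simp: extensive_def)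
    ultimately show "y \<in> {y \<in> Y. t \<sqsubseteq> y}"
      using assms le_trans[of t x "\<phi> x"] by blast
  qed
qed (use assms in simp)

text \<open>
  Greedy matching. The largest element \<open>x\<close> of \<open>X\<close> may be sent to any \<open>y \<in> Y\<close> above it: the removal
  of \<open>x\<close> and \<open>y\<close> lowers both counts by one at thresholds up to \<open>x\<close>, and beyond \<open>x\<close> the coalition
  \<open>X\<close> has nothing left to match.
\<close>

lemma tail_count_le_imp_extensive:
  assumes "X \<subseteq> carrier P" "Y \<subseteq> carrier P"
    and "\<And>t. t \<in> carrier P \<Longrightarrow> tail_count P X t \<le> tail_count P Y t"
  shows "\<exists>\<phi>. extensive P X Y \<phi>"
  using assms
proof (induction "card X" arbitrary: X Y)
  case 0
  then have "X = {}" by simp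
  then show ?case by (auto simp: extensive_def)
next
  case (Suc n)
  then have "X \<noteq> {}" by auto
  then obtain x where x: "x \<in> X" and x_max: "\<And>u. u \<in> X \<Longrightarrow> u \<sqsubseteq> x"
    using chain_max[of X] Suc.prems by blast
  have xP: "x \<in> carrier P" using x Suc.prems by blast
  have "0 < tail_count P X x"
    using x xP Suc.prems by (auto simp: tail_count_def card_gt_0_iff)
  also have "\<dots> \<le> tail_count P Y x"
    using Suc.prems xP by blast
  finally obtain y where y: "y \<in> Y" "x \<sqsubseteq> y"
    by (auto simp: tail_count_def card_gt_0_iff)
  have yP: "y \<in> carrier P" using y Suc.prems by blast
  have "\<exists>\<phi>. extensive P (X - {x}) (Y - {y}) \<phi>"
  proof (rule Suc.hyps(1))
    show "n = card (X - {x})"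
      using Suc.hyps(2) x Suc.prems by simp
    fix t assume t: "t \<in> carrier P"
    show "tail_count P (X - {x}) t \<le> tail_count P (Y - {y}) t"
    proof (cases "t \<sqsubseteq> x")
      case True
      then have "t \<sqsubseteq> y" using y t xP yP le_trans by blast
      then have Y: "{v \<in> Y - {y}. t \<sqsubseteq> v} = {v \<in> Y. t \<sqsubseteq> v} - {y}" "y \<in> {v \<in> Y. t \<sqsubseteq> v}"
        using y by auto
      have X: "{v \<in> X - {x}. t \<sqsubseteq> v} = {v \<in> X. t \<sqsubseteq> v} - {x}" "x \<in> {v \<in> X. t \<sqsubseteq> v}"
        using True x by auto
      have "tail_count P (X - {x}) t = tail_count P X t - 1"
        using X Suc.prems unfolding tail_count_def by simp
      moreover have "tail_count P (Y - {y}) t = tail_count P Y t - 1"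
        using Y Suc.prems unfolding tail_count_def by simp
      ultimately show ?thesis
        using Suc.prems(3)[OF t] by simp
    next
      case False
      then have "{v \<in> X - {x}. t \<sqsubseteq> v} = {}"
        using x_max t xP Suc.prems(1) le_trans by (auto dest!: subsetD)
      then show ?thesis by (simp only: tail_count_def) simp
    qed
  qed (use Suc.prems in auto)
  then obtain \<phi> where \<phi>: "extensive P (X - {x}) (Y - {y}) \<phi>" ..
  have "extensive P X Y (\<phi>(x := y))"
    unfolding extensive_def
  proof (intro conjI)
    show "\<phi>(x := y) \<in> X \<rightarrow> Y"
      using \<phi> y by (auto simp: extensive_def)
    have "\<phi> u \<noteq> y" if "u \<in> X - {x}" for u
      using \<phi> that by (auto simp: extensive_def)
    then show "inj_on (\<phi>(x := y)) X"
      using \<phi> by (auto simp: extensive_def inj_on_def)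
    show "\<forall>u\<in>X. u \<sqsubseteq> (\<phi>(x := y)) u"
      using \<phi> y by (auto simp: extensive_def)
  qed
  then show ?case by blast
qed

lemma CoalL_le_iff:
  assumes "X \<subseteq> carrier P" "Y \<subseteq> carrier P"
  shows "X \<sqsubseteq>\<^bsub>CoalL P\<^esub> Y \<longleftrightarrow> (\<forall>t\<in>carrier P. tail_count P X t \<le> tail_count P Y t)"
  using assms extensive_imp_tail_count_le tail_count_le_imp_extensive
  by (auto simp: CoalL_def)

lemma CoalL_le_subset:
  assumes "X \<subseteq> Y" "Y \<subseteq> carrier P"
  shows "X \<sqsubseteq>\<^bsub>CoalL P\<^esub> Y"
  using assms by (auto simp: CoalL_def extensive_def intro!: exI[of _ id])

lemma tail_count_step:
  assumes "X \<subseteq> carrier P" "t \<in> carrier P"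
  shows "tail_count P X t = strict_tail_count P X t + (if t \<in> X then 1 else 0)"
proof -
  have "{x \<in> X. t \<sqsubseteq> x} = {x \<in> X. t \<sqsubset> x} \<union> (if t \<in> X then {t} else {})"
    using assms by (auto simp: lless_eq)
  then show ?thesis
    using assms by (auto simp: tail_count_def strict_tail_count_def lless_eq card_insert_if)
qed

text \<open>
  The strict count at \<open>t\<close> is the count at the successor of \<open>t\<close>, uniformly in the coalition. This is
  what allows arguments to descend the chain.
\<close>

lemma strict_tail_count_cases:
  assumes "t \<in> carrier P"
  obtains (top) "\<And>X. X \<subseteq> carrier P \<Longrightarrow> strict_tail_count P X t = 0"
  | (succ) s where "s \<in> carrier P" "t \<sqsubset> s"
      "\<And>X. X \<subseteq> carrier P \<Longrightarrow> strict_tail_count P X t = tail_count P X s"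
proof (cases "{x \<in> carrier P. t \<sqsubset> x} = {}")
  case True
  then have "{x \<in> X. t \<sqsubset> x} = {}" if "X \<subseteq> carrier P" for X
    using that by auto
  then show thesis using top by (simp add: strict_tail_count_def)
next
  case False
  then obtain s where s: "s \<in> carrier P" "t \<sqsubset> s"
    and least: "\<And>x. x \<in> carrier P \<Longrightarrow> t \<sqsubset> x \<Longrightarrow> s \<sqsubseteq> x"
    using chain_min[of "{x \<in> carrier P. t \<sqsubset> x}"]
    by (metis (no_types, lifting) mem_Collect_eq subsetI)
  have "{x \<in> X. t \<sqsubset> x} = {x \<in> X. s \<sqsubseteq> x}" if "X \<subseteq> carrier P" for X
    using that s least assms lless_eq by (metis (no_types, lifting) Collect_cong le_antisym le_trans subsetD)
  then show thesis using succ s by (simp add: strict_tail_count_def tail_count_def)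
qed

text \<open>Membership of \<open>t\<close> is the jump of the counts between \<open>t\<close> and its successor.\<close>

lemma tail_count_eq_upset:
  assumes "X \<subseteq> carrier P" "Y \<subseteq> carrier P" "t \<in> carrier P"
    and eq: "\<And>s. s \<in> carrier P \<Longrightarrow> t \<sqsubseteq> s \<Longrightarrow> tail_count P X s = tail_count P Y s"
  shows "t \<in> X \<longleftrightarrow> t \<in> Y"
proof -
  have "strict_tail_count P X t = strict_tail_count P Y t"
    using assms(3) by (cases rule: strict_tail_count_cases) (use assms in \<open>auto simp: lless_eq\<close>)
  then show ?thesis
    using eq[of t] tail_count_step assms by (auto split: if_splits)
qed

lemma tail_count_inject:
  assumes "X \<subseteq> carrier P" "Y \<subseteq> carrier P"
    and "\<And>t. t \<in> carrier P \<Longrightarrow> tail_count P X t = tail_count P Y t"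
  shows "X = Y"
  using assms tail_count_eq_upset by blast

text \<open>
  The hypotheses on \<open>h\<close> say that the pointwise combination of two counting functions again starts
  at 0 and has jumps 0 or 1; the places where it jumps form the desired coalition. Both \<open>max\<close> and
  \<open>min\<close> are such operations, so joins and meets need only one construction.
\<close>

lemma tail_count_realize:
  fixes h :: "nat \<Rightarrow> nat \<Rightarrow> nat"
  assumes XY: "X \<subseteq> carrier P" "Y \<subseteq> carrier P"
    and h0: "h 0 0 = 0"
    and hstep: "\<And>a b i j. i \<le> 1 \<Longrightarrow> j \<le> 1 \<Longrightarrow> h a b \<le> h (a + i) (b + j) \<and> h (a + i) (b + j) \<le> h a b + 1"
  obtains Z where "Z \<subseteq> carrier P"
    "\<And>t. t \<in> carrier P \<Longrightarrow> tail_count P Z t = h (tail_count P X t) (tail_count P Y t)"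
proof
  let ?g = "\<lambda>t. h (tail_count P X t) (tail_count P Y t)"
  let ?g' = "\<lambda>t. h (strict_tail_count P X t) (strict_tail_count P Y t)"
  define Z where "Z = {t \<in> carrier P. ?g t \<noteq> ?g' t}"
  show Z: "Z \<subseteq> carrier P" by (auto simp: Z_def)
  fix t assume "t \<in> carrier P"
  then show "tail_count P Z t = ?g t"
  proof (induction "strict_tail_count P (carrier P) t" arbitrary: t rule: less_induct)
    case less
    have "strict_tail_count P Z t = ?g' t"
      using less.prems
    proof (cases rule: strict_tail_count_cases)
      case top
      then show ?thesis using XY Z h0 by simp
    next
      case (succ s)
      have "strict_tail_count P (carrier P) s < strict_tail_count P (carrier P) t"
        using succ tail_count_step[of "carrier P" s] by simp
      then show ?thesis
        using succ XY Z less.hyps[of s] by simp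
    qed
    moreover have "?g' t \<le> ?g t \<and> ?g t \<le> ?g' t + 1"
      using tail_count_step[OF XY(1) less.prems] tail_count_step[OF XY(2) less.prems]
        hstep[of "if t \<in> X then 1 else 0" "if t \<in> Y then 1 else 0"] by simp
    ultimately show ?case
      using tail_count_step[OF Z less.prems] less.prems by (auto simp: Z_def)
  qed
qed

lemma CoalL_partial_order: "partial_order (CoalL P)"
proof
  show "x .=\<^bsub>CoalL P\<^esub> y" if "x \<sqsubseteq>\<^bsub>CoalL P\<^esub> y" "y \<sqsubseteq>\<^bsub>CoalL P\<^esub> x" "x \<in> carrier (CoalL P)" "y \<in> carrier (CoalL P)" for x y
  proof -
    have "x = y"
      using that by (intro tail_count_inject) (auto simp: CoalL_le_iff intro: order_antisym)
    then show ?thesis by simp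
  qed
qed (auto simp: CoalL_le_iff intro: order_trans)

lemma CoalL_join:
  assumes "X \<subseteq> carrier P" "Y \<subseteq> carrier P"
  shows "\<exists>Z. least (CoalL P) Z (Upper (CoalL P) {X, Y}) \<and>
    (\<forall>t\<in>carrier P. tail_count P Z t = max (tail_count P X t) (tail_count P Y t))"
proof -
  obtain Z where Z: "Z \<subseteq> carrier P"
    "\<And>t. t \<in> carrier P \<Longrightarrow> tail_count P Z t = max (tail_count P X t) (tail_count P Y t)"
    by (rule tail_count_realize[OF assms, of max]) auto
  have "least (CoalL P) Z (Upper (CoalL P) {X, Y})"
    by (rule least_UpperI) (use Z assms in \<open>auto simp: CoalL_le_iff Upper_def\<close>)
  then show ?thesis using Z by blast
qed

lemma CoalL_meet:
  assumes "X \<subseteq> carrier P" "Y \<subseteq> carrier P"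
  shows "\<exists>Z. greatest (CoalL P) Z (Lower (CoalL P) {X, Y}) \<and>
    (\<forall>t\<in>carrier P. tail_count P Z t = min (tail_count P X t) (tail_count P Y t))"
proof -
  obtain Z where Z: "Z \<subseteq> carrier P"
    "\<And>t. t \<in> carrier P \<Longrightarrow> tail_count P Z t = min (tail_count P X t) (tail_count P Y t)"
    by (rule tail_count_realize[OF assms, of min]) auto
  have "greatest (CoalL P) Z (Lower (CoalL P) {X, Y})"
    by (rule greatest_LowerI) (use Z assms in \<open>auto simp: CoalL_le_iff Lower_def\<close>)
  then show ?thesis using Z by blast
qed

lemma CoalL_lattice: "lattice (CoalL P)"
proof -
  interpret C: partial_order "CoalL P" by (rule CoalL_partial_order)
  show ?thesis
  proof
    fix X Y assume "X \<in> carrier (CoalL P)" "Y \<in> carrier (CoalL P)"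
    then show "\<exists>Z. least (CoalL P) Z (Upper (CoalL P) {X, Y})"
      and "\<exists>Z. greatest (CoalL P) Z (Lower (CoalL P) {X, Y})"
      using CoalL_join[of X Y] CoalL_meet[of X Y] by auto
  qed
qed

lemma CoalL_closed:
  assumes "X \<subseteq> carrier P" "Y \<subseteq> carrier P"
  shows "X \<squnion>\<^bsub>CoalL P\<^esub> Y \<subseteq> carrier P" "X \<sqinter>\<^bsub>CoalL P\<^esub> Y \<subseteq> carrier P"
proof -
  interpret C: lattice "CoalL P" by (rule CoalL_lattice)
  show "X \<squnion>\<^bsub>CoalL P\<^esub> Y \<subseteq> carrier P" "X \<sqinter>\<^bsub>CoalL P\<^esub> Y \<subseteq> carrier P"
    using assms C.join_closed[of X Y] C.meet_closed[of X Y] by auto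
qed

lemma tail_count_join:
  assumes "X \<subseteq> carrier P" "Y \<subseteq> carrier P" "t \<in> carrier P"
  shows "tail_count P (X \<squnion>\<^bsub>CoalL P\<^esub> Y) t = max (tail_count P X t) (tail_count P Y t)"
proof -
  interpret C: lattice "CoalL P" by (rule CoalL_lattice)
  show ?thesis
  proof (rule C.joinI)
    fix Z assume "least (CoalL P) Z (Upper (CoalL P) {X, Y})"
    then show "tail_count P Z t = max (tail_count P X t) (tail_count P Y t)"
      using CoalL_join[OF assms(1,2)] C.least_unique assms(3) by blast
  qed (use assms in auto)
qed

lemma tail_count_meet:
  assumes "X \<subseteq> carrier P" "Y \<subseteq> carrier P" "t \<in> carrier P"
  shows "tail_count P (X \<sqinter>\<^bsub>CoalL P\<^esub> Y) t = min (tail_count P X t) (tail_count P Y t)"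
proof -
  interpret C: lattice "CoalL P" by (rule CoalL_lattice)
  show ?thesis
  proof (rule C.meetI)
    fix Z assume "greatest (CoalL P) Z (Lower (CoalL P) {X, Y})"
    then show "tail_count P Z t = min (tail_count P X t) (tail_count P Y t)"
      using CoalL_meet[OF assms(1,2)] C.greatest_unique assms(3) by blast
  qed (use assms in auto)
qed

lemma CoalL_distributive: "distributive_lattice (CoalL P)"
  unfolding distributive_lattice_def
proof (intro conjI ballI)
  fix X Y Z
  assume "X \<in> carrier (CoalL P)" "Y \<in> carrier (CoalL P)" "Z \<in> carrier (CoalL P)"
  then have "X \<subseteq> carrier P" "Y \<subseteq> carrier P" "Z \<subseteq> carrier P" by auto
  then show "X \<sqinter>\<^bsub>CoalL P\<^esub> (Y \<squnion>\<^bsub>CoalL P\<^esub> Z) = (X \<sqinter>\<^bsub>CoalL P\<^esub> Y) \<squnion>\<^bsub>CoalL P\<^esub> (X \<sqinter>\<^bsub>CoalL P\<^esub> Z)"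
    by (intro tail_count_inject)
      (simp_all add: CoalL_closed tail_count_join tail_count_meet min_max_distrib2)
qed (rule CoalL_lattice)

end

lemma distributive_imp_modular:
  assumes "distributive_lattice L"
  shows "modular_lattice L"
proof -
  interpret lattice L using assms by (simp add: distributive_lattice_def)
  have "x \<squnion>\<^bsub>L\<^esub> (y \<sqinter>\<^bsub>L\<^esub> z) = (x \<squnion>\<^bsub>L\<^esub> y) \<sqinter>\<^bsub>L\<^esub> z"
    if "x \<in> carrier L" "y \<in> carrier L" "z \<in> carrier L" "x \<sqsubseteq>\<^bsub>L\<^esub> z" for x y z
  proof -
    have "(x \<squnion>\<^bsub>L\<^esub> y) \<sqinter>\<^bsub>L\<^esub> z = (z \<sqinter>\<^bsub>L\<^esub> x) \<squnion>\<^bsub>L\<^esub> (z \<sqinter>\<^bsub>L\<^esub> y)"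
      using assms that by (simp add: distributive_lattice_def meet_comm[of L _ z])
    also have "z \<sqinter>\<^bsub>L\<^esub> x = x"
      using that le_iff_join[of x z] by (simp add: meet_comm[of L z])
    finally show ?thesis by (simp add: meet_comm[of L z])
  qed
  then show ?thesis
    using lattice_axioms by (auto simp: modular_lattice_def)
qed

lemma finite_imp_finite_length:
  assumes "finite (carrier L)"
  shows "finite_length L"
  using assms unfolding finite_length_def
  by (intro exI[of _ "card (carrier L)"]) (auto intro: finite_subset card_mono)

section \<open>Coalitions that agree off the least element\<close>

definition equal_off :: "('a, 'm) gorder_scheme \<Rightarrow> 'a \<Rightarrow> ('a set \<times> 'a set) set" where
  "equal_off P w = {(A, B). A \<subseteq> carrier P \<and> B \<subseteq> carrier P \<and> A \<union> {w} = B \<union> {w}}"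

locale finite_chain_least = finite_chain +
  fixes w
  assumes w_least: "least P w (carrier P)"
begin

abbreviation "T \<equiv> equal_off P w"

lemma w_closed [simp]: "w \<in> carrier P"
  and w_le: "t \<in> carrier P \<Longrightarrow> w \<sqsubseteq> t"
  and le_w_iff: "t \<in> carrier P \<Longrightarrow> t \<sqsubseteq> w \<longleftrightarrow> t = w"
  using w_least by (auto simp: least_def intro: le_antisym)

lemma tail_count_least: "X \<subseteq> carrier P \<Longrightarrow> tail_count P X w = card X"
  unfolding tail_count_def by (rule arg_cong[of _ _ card]) (use w_le in auto)

lemma equal_off_iff:
  assumes "A \<subseteq> carrier P" "B \<subseteq> carrier P"
  shows "(A, B) \<in> T \<longleftrightarrow> (\<forall>t\<in>carrier P - {w}. tail_count P A t = tail_count P B t)"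
proof
  assume "(A, B) \<in> T"
  then have AB: "A \<union> {w} = B \<union> {w}" by (simp add: equal_off_def)
  show "\<forall>t\<in>carrier P - {w}. tail_count P A t = tail_count P B t"
  proof
    fix t assume t: "t \<in> carrier P - {w}"
    then have "{x \<in> A. t \<sqsubseteq> x} = {x \<in> B. t \<sqsubseteq> x}"
      using AB le_w_iff[of t] by blast
    then show "tail_count P A t = tail_count P B t"
      by (simp add: tail_count_def)
  qed
next
  assume eq: "\<forall>t\<in>carrier P - {w}. tail_count P A t = tail_count P B t"
  have "t \<in> A \<longleftrightarrow> t \<in> B" if t: "t \<in> carrier P" "t \<noteq> w" for t
    by (rule tail_count_eq_upset[OF assms t(1)]) (use eq t le_w_iff in blast)
  then have "A \<union> {w} = B \<union> {w}"
    using assms by blast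
  then show "(A, B) \<in> T"
    using assms by (simp add: equal_off_def)
qed

lemma equal_off_compatible: "compatible (CoalL P) T"
  unfolding compatible_def
proof (clarify)
  fix A B C D assume "(A, B) \<in> T" "(C, D) \<in> T"
  moreover from this have "A \<subseteq> carrier P" "B \<subseteq> carrier P" "C \<subseteq> carrier P" "D \<subseteq> carrier P"
    by (auto simp: equal_off_def)
  ultimately show "(A \<squnion>\<^bsub>CoalL P\<^esub> C, B \<squnion>\<^bsub>CoalL P\<^esub> D) \<in> T \<and> (A \<sqinter>\<^bsub>CoalL P\<^esub> C, B \<sqinter>\<^bsub>CoalL P\<^esub> D) \<in> T"
    by (simp add: equal_off_iff CoalL_closed tail_count_join tail_count_meet)
qed

lemma equal_off_congruence: "congruence (CoalL P) T"
  unfolding congruence_def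
  by (intro conjI CoalL_lattice equal_off_compatible equivI)
    (auto simp: equal_off_def refl_on_def sym_def trans_def)

text \<open>
  Stated for arbitrary sets of pairwise related coalitions, this serves both to bound the blocks and
  to prove that a given pair is maximal, hence a block.
\<close>

lemma equal_off_square_subset:
  assumes "X \<times> X \<subseteq> T" "A \<in> X"
  shows "X \<subseteq> {A - {w}, insert w A}"
proof
  fix B assume "B \<in> X"
  then have "A \<union> {w} = B \<union> {w}" using assms by (auto simp: equal_off_def)
  then show "B \<in> {A - {w}, insert w A}" by (cases "w \<in> B") auto
qed

lemma equal_off_doubling_tolerance: "doubling_tolerance (CoalL P) T"
proof -
  have "finite X \<and> card X \<le> 2" if "X \<in> blocks (CoalL P) T" for X
  proof (cases "X = {}")
    case False
    then obtain A where "A \<in> X" by blast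
    then have X: "X \<subseteq> {A - {w}, insert w A}"
      using that equal_off_square_subset by (auto simp: blocks_def)
    have "card X \<le> card {A - {w}, insert w A}"
      using X by (intro card_mono) auto
    also have "\<dots> \<le> 2" by (simp add: card_insert_if)
    finally show ?thesis using X finite_subset by blast
  qed simp
  moreover have "tolerance (CoalL P) T"
    using equal_off_congruence
    by (auto simp: congruence_def tolerance_def equiv_def equal_off_def)
  ultimately show ?thesis
    unfolding doubling_tolerance_def
    using CoalL_distributive finite_carrier
    by (auto intro: distributive_imp_modular finite_imp_finite_length)
qed

lemma tol_prec_equal_off_iff:
  "tol_prec (CoalL P) T A B \<longleftrightarrow> A \<subseteq> carrier P - {w} \<and> B = insert w A"
proof
  interpret C: lattice "CoalL P" by (rule CoalL_lattice)
  assume prec: "tol_prec (CoalL P) T A B"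
  let ?I = "\<lbrace>A..B\<rbrace>\<^bsub>CoalL P\<^esub>"
  have AB: "A \<in> carrier (CoalL P)" "B \<in> carrier (CoalL P)" and card: "card ?I = 2"
    and block: "?I \<times> ?I \<subseteq> T"
    using prec by (auto simp: tol_prec_def blocks_def)
  obtain X where "X \<in> ?I" using card by fastforce
  then have le: "A \<sqsubseteq>\<^bsub>CoalL P\<^esub> B"
    using AB C.le_trans[of A X B] by (auto simp: at_least_at_most_def)
  have "A \<noteq> B"
  proof
    assume "A = B"
    then have "?I \<subseteq> {A}"
      using AB C.le_antisym unfolding at_least_at_most_def by blast
    then have "card ?I \<le> card {A}"
      by (intro card_mono) auto
    then show False
      using card by simp
  qed
  moreover have "A \<in> ?I" "B \<in> ?I"
    using AB le C.le_refl by (auto simp: at_least_at_most_def)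
  then have eq: "A \<union> {w} = B \<union> {w}"
    using block by (auto simp: equal_off_def)
  moreover have "w \<notin> A"
  proof
    assume "w \<in> A"
    then have "B \<sqsubseteq>\<^bsub>CoalL P\<^esub> A"
      using eq AB by (intro CoalL_le_subset) auto
    then show False
      using \<open>A \<noteq> B\<close> le AB C.le_antisym by blast
  qed
  ultimately show "A \<subseteq> carrier P - {w} \<and> B = insert w A"
    using AB by auto
next
  interpret C: lattice "CoalL P" by (rule CoalL_lattice)
  assume AB: "A \<subseteq> carrier P - {w} \<and> B = insert w A"
  then have A: "A \<subseteq> carrier P" "w \<notin> A" and B: "B = insert w A" "B \<subseteq> carrier P" by auto
  have AB_T: "(A, B) \<in> T" using A B by (auto simp: equal_off_def)
  have interval: "\<lbrace>A..B\<rbrace>\<^bsub>CoalL P\<^esub> = {A, B}"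
  proof
    show "{A, B} \<subseteq> \<lbrace>A..B\<rbrace>\<^bsub>CoalL P\<^esub>"
      using A B by (auto simp: at_least_at_most_def intro!: CoalL_le_subset)
    show "\<lbrace>A..B\<rbrace>\<^bsub>CoalL P\<^esub> \<subseteq> {A, B}"
    proof
      fix C assume "C \<in> \<lbrace>A..B\<rbrace>\<^bsub>CoalL P\<^esub>"
      then have C: "C \<subseteq> carrier P" "A \<sqsubseteq>\<^bsub>CoalL P\<^esub> C" "C \<sqsubseteq>\<^bsub>CoalL P\<^esub> B"
        by (auto simp: at_least_at_most_def)
      then have "(A, C) \<in> T"
        using AB_T A(1) B(2) by (simp add: equal_off_iff CoalL_le_iff) (metis order_antisym DiffD1)
      then show "C \<in> {A, B}"
        using A B by (cases "w \<in> C") (auto simp: equal_off_def)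
    qed
  qed
  moreover have "{A, B} \<in> blocks (CoalL P) T"
    using A B equal_off_square_subset[of _ A] by (auto simp: blocks_def equal_off_def)
  moreover have "A \<noteq> B" using A B by blast
  then have "card {A, B} = 2" by simp
  ultimately show "tol_prec (CoalL P) T A B"
    using A B by (simp add: tol_prec_def)
qed

section \<open>The order of the doubled lattice\<close>

text \<open>
  The witness is \<open>B\<close> without its smallest element \<open>b\<close>. This removal lowers the count by one exactly
  at the thresholds up to \<open>b\<close>, where the count of \<open>B\<close> is the full \<open>card B > card A\<close>. Taking the
  smallest element also ensures that \<open>w\<close> is gone if it was in \<open>B\<close>, and \<open>w\<close> can then be sent back
  to \<open>b\<close>.
\<close>

lemma coalition_interpolate:
  assumes "A \<subseteq> carrier P" "B \<subseteq> carrier P" "A \<sqsubseteq>\<^bsub>CoalL P\<^esub> B" "card A < card B"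
  obtains A' where "A' \<subseteq> carrier P - {w}" "A \<sqsubseteq>\<^bsub>CoalL P\<^esub> A'" "insert w A' \<sqsubseteq>\<^bsub>CoalL P\<^esub> B"
proof -
  have "B \<noteq> {}" using assms by auto
  then obtain b where b: "b \<in> B" and b_min: "\<And>x. x \<in> B \<Longrightarrow> b \<sqsubseteq> x"
    using chain_min[of B] assms by blast
  have bP: "b \<in> carrier P" using b assms by blast
  have wb: "w \<in> B \<Longrightarrow> w = b"
    using b_min[of w] le_w_iff[OF bP] by auto
  then have sub: "B - {b} \<subseteq> carrier P - {w}"
    using assms by auto
  then have sub': "B - {b} \<subseteq> carrier P" by auto
  have "A \<sqsubseteq>\<^bsub>CoalL P\<^esub> B - {b}"
    unfolding CoalL_le_iff[OF assms(1) sub']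
  proof
    fix t assume t: "t \<in> carrier P"
    show "tail_count P A t \<le> tail_count P (B - {b}) t"
    proof (cases "t \<sqsubseteq> b")
      case True
      then have "{x \<in> B - {b}. t \<sqsubseteq> x} = B - {b}"
        using b_min le_trans[of t b] t bP assms(2) by blast
      then have "tail_count P (B - {b}) t = card B - 1"
        using b assms(2) by (simp add: tail_count_def)
      moreover have "tail_count P A t \<le> card A"
        using assms(1) by (auto simp: tail_count_def intro: card_mono)
      ultimately show ?thesis using assms(4) by simp
    next
      case False
      then have "{x \<in> B - {b}. t \<sqsubseteq> x} = {x \<in> B. t \<sqsubseteq> x}" by auto
      then show ?thesis
        using assms t by (simp add: CoalL_le_iff tail_count_def)
    qed
  qed
  moreover have "extensive P (insert w (B - {b})) B (id(w := b))"
    using b bP wb w_le assms(2) by (auto simp: extensive_def inj_on_def)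
  then have "insert w (B - {b}) \<sqsubseteq>\<^bsub>CoalL P\<^esub> B"
    by (auto simp: CoalL_def)
  ultimately show thesis
    using that sub by blast
qed

text \<open>
  This replaces the transitive closure by an explicit condition. In particular, it shows that the
  closure is antisymmetric.
\<close>

lemma doubling_le_iff:
  assumes "A \<subseteq> carrier P" "B \<subseteq> carrier P" "i \<in> {0, 1}" "j \<in> {0, 1}"
  shows "(A, i) \<sqsubseteq>\<^bsub>doubling (CoalL P) T\<^esub> (B, j) \<longleftrightarrow>
    A \<sqsubseteq>\<^bsub>CoalL P\<^esub> B \<and> card A + i \<le> card B + j"
proof -
  interpret C: lattice "CoalL P" by (rule CoalL_lattice)
  let ?r = "doubling_pi (CoalL P) \<union> doubling_tau (CoalL P) T"
  let ?s = "{((A, i), (B, j)) | A i B j. A \<subseteq> carrier P \<and> B \<subseteq> carrier P \<and>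
    A \<sqsubseteq>\<^bsub>CoalL P\<^esub> B \<and> card A + i \<le> card B + (j :: nat)}"
  have pi: "((A, i), (B, j)) \<in> ?r" if "A \<subseteq> carrier P" "B \<subseteq> carrier P" "i \<in> {0, 1}" "j \<in> {0, 1}"
    "A \<sqsubseteq>\<^bsub>CoalL P\<^esub> B" "i \<le> j" for A B i j
    using that by (auto simp: doubling_pi_def)
  have card_le: "card A \<le> card B" if "A \<subseteq> carrier P" "B \<subseteq> carrier P" "A \<sqsubseteq>\<^bsub>CoalL P\<^esub> B" for A B
    using that CoalL_le_iff[of A B] tail_count_least[of A] tail_count_least[of B] w_closed by metis
  have "?r \<subseteq> ?s"
  proof -
    have "A \<sqsubseteq>\<^bsub>CoalL P\<^esub> insert w A \<and> card A + 1 \<le> card (insert w A)" if "A \<subseteq> carrier P - {w}" for A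
    proof -
      have "A \<subseteq> carrier P" "w \<notin> A" using that by auto
      then show ?thesis by (simp add: CoalL_le_subset subset_insertI)
    qed
    then have "doubling_tau (CoalL P) T \<subseteq> ?s"
      by (auto simp: doubling_tau_def tol_prec_equal_off_iff)
    moreover have "doubling_pi (CoalL P) \<subseteq> ?s"
    proof
      fix p assume "p \<in> doubling_pi (CoalL P)"
      then obtain A i B j where p: "p = ((A, i), (B, j))" "A \<subseteq> carrier P" "B \<subseteq> carrier P"
          "A \<sqsubseteq>\<^bsub>CoalL P\<^esub> B" "i \<le> j"
        by (auto simp: doubling_pi_def)
      then show "p \<in> ?s"
        using card_le[of A B] by simp
    qed
    ultimately show ?thesis by blast
  qed
  moreover have "trans ?s"
  proof (rule transI)
    fix p q v assume "(p, q) \<in> ?s" "(q, v) \<in> ?s"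
    then show "(p, v) \<in> ?s"
      using C.le_trans[of "fst p" "fst q" "fst v"] by auto
  qed
  ultimately have "?r\<^sup>+ \<subseteq> ?s"
    using trancl_mono_subset[of ?r ?s] trancl_id[of ?s] by simp
  then have "((A, i), (B, j)) \<in> ?r\<^sup>+ \<Longrightarrow> A \<sqsubseteq>\<^bsub>CoalL P\<^esub> B \<and> card A + i \<le> card B + j"
    by fast
  moreover have "((A, i), (B, j)) \<in> ?r\<^sup>+" if le: "A \<sqsubseteq>\<^bsub>CoalL P\<^esub> B" "card A + i \<le> card B + j"
  proof (cases "i \<le> j")
    case True
    then show ?thesis using pi assms le by blast
  next
    case False
    then have ij: "i = 1" "j = 0" using assms by auto
    then obtain A' where A': "A' \<subseteq> carrier P - {w}" "A \<sqsubseteq>\<^bsub>CoalL P\<^esub> A'" "insert w A' \<sqsubseteq>\<^bsub>CoalL P\<^esub> B"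
      using coalition_interpolate[of A B] assms le by auto
    have "((A, i), (A', 1)) \<in> ?r" "((insert w A', 0), (B, j)) \<in> ?r"
      using pi[of A A' 1 1] pi[of "insert w A'" B 0 0] A' assms ij by auto
    moreover have "((A', 1), (insert w A', 0)) \<in> ?r"
      using A' by (simp add: doubling_tau_def tol_prec_equal_off_iff)
    ultimately show ?thesis by (meson trancl.intros)
  qed
  ultimately show ?thesis by (auto simp: doubling_def)
qed

end

text \<open>
  An order isomorphism is required to have a partial order as its source. For the doubling
  construction this is inherited along the map to the coalitions of the longer chain.
\<close>

lemma partial_order_pullback:
  assumes "partial_order B" "inj_on f (carrier A)" "f ` carrier A \<subseteq> carrier B" "eq A = (=)"
    and le: "\<And>x y. x \<in> carrier A \<Longrightarrow> y \<in> carrier A \<Longrightarrow> f x \<sqsubseteq>\<^bsub>B\<^esub> f y \<longleftrightarrow> x \<sqsubseteq>\<^bsub>A\<^esub> y"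
  shows "partial_order A"
proof -
  interpret B: partial_order B by fact
  have f: "f x \<in> carrier B" if "x \<in> carrier A" for x using assms(3) that by blast
  show ?thesis
  proof
    fix x y assume "x \<sqsubseteq>\<^bsub>A\<^esub> y" "y \<sqsubseteq>\<^bsub>A\<^esub> x" "x \<in> carrier A" "y \<in> carrier A"
    then show "x .=\<^bsub>A\<^esub> y"
      using le f B.le_antisym[of "f x" "f y"] assms(2) by (simp add: inj_on_eq_iff assms(4))
  next
    fix x y v assume "x \<sqsubseteq>\<^bsub>A\<^esub> y" "y \<sqsubseteq>\<^bsub>A\<^esub> v" "x \<in> carrier A" "y \<in> carrier A" "v \<in> carrier A"
    then show "x \<sqsubseteq>\<^bsub>A\<^esub> v"
      using le f B.le_trans[of "f x" "f y" "f v"] by metis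
  qed (auto simp: assms(4) le[symmetric] f)
qed

lemma total_order_subset:
  assumes "total_order P" "S \<subseteq> carrier P"
  shows "total_order (P\<lparr>carrier := S\<rparr>)"
proof -
  interpret total_order P by fact
  have S: "x \<in> carrier P" if "x \<in> S" for x using assms(2) that by blast
  show ?thesis
    by unfold_locales (auto simp: S eq_is_equal total intro: le_trans)
qed

text \<open>
  Here \<open>w\<close> is the least element of the longer chain \<open>P\<close>, and \<open>v\<close> that of the chain \<open>P'\<close> above it.
  The label 1 is turned into membership of \<open>w\<close>. Thresholds in \<open>P'\<close> do not see \<open>w\<close>, and the
  remaining threshold \<open>w\<close> compares cardinalities.
\<close>

lemma (in finite_chain_least) order_isomorphic_doubling:
  assumes P': "P' = P\<lparr>carrier := carrier P - {w}\<rparr>" and v: "least P' v (carrier P')"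
  shows "order_isomorphic (doubling (CoalL P') (equal_off P' v)) (CoalL P)"
proof -
  interpret P': finite_chain_least P' v
    unfolding finite_chain_least_def finite_chain_def finite_chain_axioms_def finite_chain_least_axioms_def
    using total_order_subset[of P "carrier P - {w}"] total_order_axioms finite_carrier v by (auto simp: P')
  have carrier': "carrier P' = carrier P - {w}" by (simp add: P')
  let ?D = "doubling (CoalL P') (equal_off P' v)"
  define f :: "'a set \<times> nat \<Rightarrow> 'a set" where "f = (\<lambda>(A, i). if i = 1 then insert w A else A)"
  have f_closed: "f (A, i) \<subseteq> carrier P" if "A \<subseteq> carrier P'" for A i
    using that by (auto simp: f_def carrier')
  have card_f: "card (f (A, i)) = card A + i" if "A \<subseteq> carrier P'" "i \<in> {0, 1}" for A i
    using that P'.finite_coalition[of A] by (auto simp: f_def carrier' card_insert_if)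
  have count_f: "tail_count P (f (A, i)) t = tail_count P' A t" if "t \<in> carrier P'" for A i t
  proof -
    have "{x \<in> f (A, i). t \<sqsubseteq> x} = {x \<in> A. t \<sqsubseteq> x}"
      using that le_w_iff[of t] by (auto simp: f_def carrier')
    then show ?thesis by (simp add: tail_count_def P')
  qed
  have carrier: "carrier P = insert w (carrier P')" by (auto simp: carrier')
  have D: "carrier ?D = Pow (carrier P') \<times> {0, 1}" "eq ?D = (=)"
    by (simp_all add: doubling_def)
  have le: "f x \<sqsubseteq>\<^bsub>CoalL P\<^esub> f y \<longleftrightarrow> x \<sqsubseteq>\<^bsub>?D\<^esub> y" if "x \<in> carrier ?D" "y \<in> carrier ?D" for x y
  proof -
    obtain A i B j where xy: "x = (A, i)" "y = (B, j)" by fastforce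
    then have AB: "A \<subseteq> carrier P'" "B \<subseteq> carrier P'" "i \<in> {0, 1}" "j \<in> {0, 1}"
      using that by (auto simp: D)
    have "tail_count P (f x) w = card A + i" "tail_count P (f y) w = card B + j"
      unfolding xy using AB tail_count_least f_closed card_f by metis+
    then have "f x \<sqsubseteq>\<^bsub>CoalL P\<^esub> f y \<longleftrightarrow> card A + i \<le> card B + j \<and>
        (\<forall>t\<in>carrier P'. tail_count P' A t \<le> tail_count P' B t)"
      unfolding xy CoalL_le_iff[OF f_closed[OF AB(1)] f_closed[OF AB(2)]]
      by (simp add: carrier count_f)
    also have "\<dots> \<longleftrightarrow> x \<sqsubseteq>\<^bsub>?D\<^esub> y"
      unfolding xy P'.doubling_le_iff[OF AB] P'.CoalL_le_iff[OF AB(1,2)] by auto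
    finally show ?thesis .
  qed
  have "bij_betw f (carrier ?D) (carrier (CoalL P))"
    by (rule bij_betw_byWitness[where f' = "\<lambda>X. (X - {w}, if w \<in> X then 1 else 0)"])
      (auto simp: f_def D carrier' split: if_splits)
  then have "inj_on f (carrier ?D)" "f ` carrier ?D \<subseteq> carrier (CoalL P)"
    and bij: "bij_betw f (carrier ?D) (carrier (CoalL P))"
    by (simp_all add: bij_betw_def)
  then have "partial_order ?D"
    using partial_order_pullback[OF CoalL_partial_order _ _ D(2) le] by blast
  then show ?thesis
    unfolding order_isomorphic_def order_emb_def
    using bij le CoalL_partial_order by (blast intro: partial_order.axioms(1))
qed

section \<open>Adding a least element doubles the coalition lattice\<close>

theorem lemma3p4:
  fixes P P' :: "'a gorder" and z w :: 'a and T :: "('a set \<times> 'a set) set"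
  assumes "total_order P" and "finite (carrier P)" and "card (carrier P) \<noteq> 1"
    and "least P z (carrier P)" and "is_atom P w"
    and "P' = principal_filter P w"
    and "T = {(A, B). A \<in> carrier (CoalL P') \<and> B \<in> carrier (CoalL P') \<and> A \<union> {w} = B \<union> {w}}"
  shows "doubling_tolerance (CoalL P') T \<and>
         order_isomorphic (doubling (CoalL P') T) (CoalL P) \<and>
         congruence (CoalL P') T \<and>
         distributive_lattice (CoalL P') \<and>
         distributive_lattice (CoalL P)"
proof -
  interpret P: finite_chain_least P z
    using assms(1,2,4)
    by (simp add: finite_chain_least_def finite_chain_def finite_chain_axioms_def finite_chain_least_axioms_def)
  have P': "P' = P\<lparr>carrier := carrier P - {z}\<rparr>"
    unfolding assms(6) by (rule principal_filter_atom[OF assms(1,4,5)])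
  have "w \<in> carrier P"
    using assms(5) by (auto simp: is_atom_def covers_def)
  then have w: "least P' w (carrier P')"
    using P.le_refl by (auto simp: assms(6) principal_filter_def least_def)
  interpret P': finite_chain_least P' w
    unfolding finite_chain_least_def finite_chain_def finite_chain_axioms_def finite_chain_least_axioms_def
    using total_order_subset[of P "carrier P - {z}"] assms(1,2) w by (auto simp: P')
  have T: "T = equal_off P' w"
    by (simp add: assms(7) equal_off_def)
  show ?thesis
    unfolding T
    using P'.equal_off_doubling_tolerance P.order_isomorphic_doubling[OF P' w]
      P'.equal_off_congruence P'.CoalL_distributive P.CoalL_distributive by blast
qed

end
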